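(* Let $G$ be a finite group. If $G$ is of odd order, then the edge covering number is $\beta'(\mathcal{P}_e(G)) = \dfrac{|G|+1}{2}$. If $G$ is of even order, then $$\frac{|G|}{2} \leq \beta'(\mathcal{P}_e(G)) \leq \frac{|G|+(t-1)}{2},$$ where $t$ is the number of involutions in $G$.
   Context: The enhanced power graph $\mathcal{P}_e(G)$ of a group $G$ is the simple undirected graph with vertex set $G$ in which two distinct vertices are adjacent if and only if they belong to a common cyclic subgroup of $G$. An involution is an element of order $2$. An edge cover of a graph $\Gamma$ is a set of edges such that every vertex of $\Gamma$ is incident to some edge in the set; the edge covering number $\beta'(\Gamma)$ is the minimum cardinality of an edge cover.
   Formalization: In the odd-order case the trivial group is excluded: its enhanced power graph is a single isolated vertex, which has no edge cover, so the edge covering number is undefined there. *)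

theory Defs
  imports Complex_Main "HOL-Algebra.Elementary_Groups" "HOL-Algebra.Multiplicative_Group"
begin

text \<open>
  A simple undirected graph is a pair of a vertex set and a set of edges, where an edge is a
  two-element set of vertices.
\<close>

type_synonym 'a ugraph = "'a set \<times> 'a set set"

abbreviation vertices :: "'a ugraph \<Rightarrow> 'a set" where
  "vertices \<equiv> fst"

abbreviation edges :: "'a ugraph \<Rightarrow> 'a set set" where
  "edges \<equiv> snd"

definition edge_cover :: "'a ugraph \<Rightarrow> 'a set set \<Rightarrow> bool" where
  "edge_cover \<Gamma> F \<longleftrightarrow> F \<subseteq> edges \<Gamma> \<and> (\<forall>v\<in>vertices \<Gamma>. \<exists>e\<in>F. v \<in> e)"

text \<open>
  The finiteness condition keeps infinite covers, whose \<^const>\<open>card\<close> is 0, out of the minimum.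
  A graph with an isolated vertex has no edge cover, so that its edge covering number is
  mathematically undefined; here it is then \<open>Inf {} = 0\<close>.
\<close>

definition edge_covering_number :: "'a ugraph \<Rightarrow> nat" where
  "edge_covering_number \<Gamma> = Inf {card F | F. edge_cover \<Gamma> F \<and> finite F}"

definition enhanced_power_graph :: "('a, 'b) monoid_scheme \<Rightarrow> 'a ugraph" where
  "enhanced_power_graph G =
     (carrier G,
      {{x, y} | x y. x \<in> carrier G \<and> y \<in> carrier G \<and> x \<noteq> y \<and>
         (\<exists>C. subgroup C G \<and> cyclic_group (G\<lparr>carrier := C\<rparr>) \<and> x \<in> C \<and> y \<in> C)})"

definition involutions :: "('a, 'b) monoid_scheme \<Rightarrow> 'a set" where
  "involutions G = {x \<in> carrier G. group.ord G x = 2}"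

end

(* Every edge has two endpoints, so an edge cover has at least |G|/2 edges. Conversely, x and its
   inverse lie in the cyclic subgroup generated by x, so the elements with x different from its
   inverse are covered by disjoint edges {x, inv x}; the remaining nontrivial elements are the
   involutions, each of which is joined to 1. If there are no involutions, 1 is instead covered by
   one further edge {1, z}. Counting also shows that |G| - 1 - t is even, so that an even |G|
   forces t to be odd and hence positive. *)

theory Submission
  imports Defs
begin

lemma edge_covering_number_le:
  assumes "edge_cover \<Gamma> F" and "finite F"
  shows "edge_covering_number \<Gamma> \<le> card F"
  unfolding edge_covering_number_def by (rule wellorder_Inf_le1) (use assms in blast)

text \<open>The given \<open>F\<close> makes the set of cardinalities nonempty, so by well-ordering
  its infimum is attained and is not the default value of \<open>Inf {}\<close>.\<close>

lemma obtain_minimum_edge_cover: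
  assumes "edge_cover \<Gamma> F" and "finite F"
  obtains F' where "edge_cover \<Gamma> F'" and "finite F'" and "card F' = edge_covering_number \<Gamma>"
proof -
  have "edge_covering_number \<Gamma> \<in> {card F | F. edge_cover \<Gamma> F \<and> finite F}"
    unfolding edge_covering_number_def by (rule wellorder_InfI) (use assms in blast)
  then show thesis
    using that by auto
qed

lemma card_vertices_le_edge_cover:
  assumes "edge_cover \<Gamma> F" and "finite F" and "\<And>e. e \<in> edges \<Gamma> \<Longrightarrow> card e = 2"
  shows "card (vertices \<Gamma>) \<le> 2 * card F"
proof -
  have card2: "card e = 2" if "e \<in> F" for e
    using assms that by (auto simp: edge_cover_def)
  \<comment> \<open>An infinite edge would have \<open>card\<close> 0 instead of 2, so every edge is
    finite.\<close>
  have "finite (\<Union>F)"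
    using assms(2) card2 card.infinite by (metis finite_Union zero_neq_numeral)
  moreover have "vertices \<Gamma> \<subseteq> \<Union>F"
    using assms(1) by (auto simp: edge_cover_def)
  ultimately have "card (vertices \<Gamma>) \<le> card (\<Union>F)"
    by (rule card_mono)
  also have "\<dots> \<le> (\<Sum>e\<in>F. card e)"
    by (rule card_Union_le_sum_card)
  also have "\<dots> = 2 * card F"
    using card2 by simp
  finally show ?thesis .
qed

lemma vertices_enhanced_power_graph [simp]:
  "vertices (enhanced_power_graph G) = carrier G"
  by (simp add: enhanced_power_graph_def)

lemma card_edge_enhanced_power_graph:
  "e \<in> edges (enhanced_power_graph G) \<Longrightarrow> card e = 2"
  by (auto simp: enhanced_power_graph_def)

context group
begin

text \<open>The subgroup generated by \<open>x\<close> itself is the common cyclic subgroup. Needed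
  for \<open>y = inv x\<close> and \<open>y = \<one>\<close>.\<close>

lemma edge_enhanced_power_graph_generate:
  assumes "x \<in> carrier G" and "y \<in> generate G {x}" and "x \<noteq> y"
  shows "{x, y} \<in> edges (enhanced_power_graph G)"
proof -
  have "subgroup (generate G {x}) G"
    using assms(1) by (intro generate_is_subgroup) simp
  moreover have "cyclic_group (G\<lparr>carrier := generate G {x}\<rparr>)"
    using cyclic_group_generated[of x] assms(1) by (simp add: subgroup_generated_def)
  moreover have "x \<in> generate G {x}"
    by (simp add: generate.incl)
  moreover have "y \<in> carrier G"
    using calculation(1) assms(2) by (rule subgroup.mem_carrier)
  ultimately show ?thesis
    using assms unfolding enhanced_power_graph_def by auto
qed

lemma involutions_iff: "x \<in> involutions G \<longleftrightarrow> x \<in> carrier G \<and> x \<noteq> \<one> \<and> inv x = x"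
proof (cases "x \<in> carrier G")
  case True
  have "ord x = 2 \<longleftrightarrow> ord x dvd 2 \<and> ord x \<noteq> 1"
    \<comment> \<open>The second fact excludes \<open>ord x = 0\<close>, the value at elements of
      infinite order.\<close>
    using dvd_imp_le[of "ord x" 2] dvd_0_left_iff[of 2] by (auto simp: le_Suc_eq numeral_2_eq_2)
  also have "\<dots> \<longleftrightarrow> x [^] (2::nat) = \<one> \<and> x \<noteq> \<one>"
    using True by (simp only: pow_eq_id ord_eq_1)
  also have "\<dots> \<longleftrightarrow> x \<noteq> \<one> \<and> inv x = x"
    using True by (auto simp: numeral_2_eq_2 inv_equality) (metis r_inv)
  finally show ?thesis
    using True by (simp add: involutions_def)
qed (simp add: involutions_def)

text \<open>By Lagrange, the order of an element divides the order of the group.\<close>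

lemma involutions_odd_order:
  assumes "odd (order G)"
  shows "involutions G = {}"
proof -
  have "ord x \<noteq> 2" if "x \<in> carrier G" for x
    using ord_dvd_group_order[OF that] assms by auto
  then show ?thesis
    by (auto simp: involutions_def)
qed

definition inverse_pairs :: "'a set set" where
  "inverse_pairs = (\<lambda>x. {x, inv x}) ` {x \<in> carrier G. inv x \<noteq> x}"

lemma Union_inverse_pairs: "\<Union>inverse_pairs = {x \<in> carrier G. inv x \<noteq> x}"
  by (auto simp: inverse_pairs_def)

text \<open>The group splits into the identity, the involutions and the elements covered by the
  pairs. The additive form avoids truncated subtraction.\<close>

lemma card_inverse_pairs:
  assumes "finite (carrier G)"
  shows "2 * card inverse_pairs + card (involutions G) + 1 = order G"
proof -
  let ?N = "{x \<in> carrier G. inv x \<noteq> x}"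
  have "2 * card inverse_pairs = card (\<Union>inverse_pairs)"
  proof (rule card_partition)
    show "finite inverse_pairs"
      using assms by (simp add: inverse_pairs_def)
    show "finite (\<Union>inverse_pairs)"
      using assms by (simp add: Union_inverse_pairs)
    show "card e = 2" if "e \<in> inverse_pairs" for e
      using that by (auto simp: inverse_pairs_def card_2_iff)
    \<comment> \<open>Inversion is self-inverse, so either member of a pair determines the
      pair.\<close>
    show "e \<inter> e' = {}" if "e \<in> inverse_pairs" "e' \<in> inverse_pairs" "e \<noteq> e'" for e e'
      using that by (auto simp: inverse_pairs_def)
  qed
  then have "2 * card inverse_pairs = card ?N"
    by (simp add: Union_inverse_pairs)
  moreover have "carrier G = insert \<one> (?N \<union> involutions G)"
    by (auto simp: involutions_iff)
  moreover have "card (insert \<one> (?N \<union> involutions G)) = Suc (card ?N + card (involutions G))"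
  proof -
    have "finite (involutions G)"
      using assms by (simp add: involutions_def)
    moreover have "?N \<inter> involutions G = {}" "\<one> \<notin> ?N \<union> involutions G"
      by (auto simp: involutions_iff)
    ultimately show ?thesis
      using assms by (simp add: card_Un_disjoint)
  qed
  ultimately show ?thesis
    by (simp add: order_def)
qed

text \<open>The parameter \<open>S\<close> serves both parities: it will be the set of involutions
  for even order and a single nontrivial element for odd order. Being nonempty, it gives an edge
  that covers \<open>\<one>\<close>.\<close>

lemma edge_cover_inverse_pairs:
  assumes "involutions G \<subseteq> S" and "S \<subseteq> carrier G - {\<one>}" and "S \<noteq> {}"
  shows "edge_cover (enhanced_power_graph G) (inverse_pairs \<union> (\<lambda>y. {y, \<one>}) ` S)"
    (is "edge_cover ?\<Gamma> (_ \<union> ?star)")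
proof -
  have "inverse_pairs \<subseteq> edges ?\<Gamma>"
    by (auto simp: inverse_pairs_def generate.inv intro!: edge_enhanced_power_graph_generate)
  moreover have "?star \<subseteq> edges ?\<Gamma>"
    using assms(2) by (auto simp: generate.one intro!: edge_enhanced_power_graph_generate)
  moreover have "\<exists>e\<in>inverse_pairs \<union> ?star. v \<in> e" if "v \<in> carrier G" for v
  proof -
    consider "inv v \<noteq> v" | "v = \<one>" | "v \<in> involutions G"
      using \<open>v \<in> carrier G\<close> involutions_iff by auto
    then show ?thesis
    proof cases
      case 1
      with that have "v \<in> \<Union>inverse_pairs"
        by (simp add: Union_inverse_pairs)
      then show ?thesis
        by blast
    qed (use assms in blast)+
  qed
  ultimately show ?thesis
    by (simp add: edge_cover_def)
qed

lemma edge_covering_number_enhanced_power_graph_bounds: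
  assumes fin: "finite (carrier G)"
    and S: "involutions G \<subseteq> S" "S \<subseteq> carrier G - {\<one>}" "S \<noteq> {}"
  shows "order G \<le> 2 * edge_covering_number (enhanced_power_graph G)"
    and "2 * edge_covering_number (enhanced_power_graph G) + card (involutions G) + 1
           \<le> order G + 2 * card S"
proof -
  let ?\<Gamma> = "enhanced_power_graph G"
  let ?F = "inverse_pairs \<union> (\<lambda>y. {y, \<one>}) ` S"
  have cover: "edge_cover ?\<Gamma> ?F"
    using S by (rule edge_cover_inverse_pairs)
  have finS: "finite S"
    using fin S(2) by (meson finite_Diff finite_subset)
  then have finF: "finite ?F"
    using fin by (simp add: inverse_pairs_def)
  obtain F where F: "edge_cover ?\<Gamma> F" "finite F" "card F = edge_covering_number ?\<Gamma>"
    using cover finF by (rule obtain_minimum_edge_cover)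
  show "order G \<le> 2 * edge_covering_number ?\<Gamma>"
    using card_vertices_le_edge_cover[OF F(1,2) card_edge_enhanced_power_graph] F(3)
    by (simp add: order_def)
  have "edge_covering_number ?\<Gamma> \<le> card ?F"
    using cover finF by (rule edge_covering_number_le)
  \<comment> \<open>Twice the right-hand side is
    \<open>order G - card (involutions G) - 1 + 2 * card S\<close>, by the count of inverse
    pairs.\<close>
  also have "\<dots> \<le> card inverse_pairs + card S"
    using card_Un_le[of inverse_pairs] card_image_le[OF finS] by (meson add_left_mono order_trans)
  finally show "2 * edge_covering_number ?\<Gamma> + card (involutions G) + 1 \<le> order G + 2 * card S"
    using card_inverse_pairs[OF fin] by linarith
qed

end

theorem corollary3p6:
  fixes G :: "('a, 'b) monoid_scheme" and t :: nat
  assumes "group G" and "finite (carrier G)"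
    and "t = card (involutions G)"
  shows "(odd (order G) \<and> order G \<noteq> 1 \<longrightarrow>
            real (edge_covering_number (enhanced_power_graph G)) = (real (order G) + 1) / 2) \<and>
         (even (order G) \<longrightarrow>
            real (order G) / 2 \<le> real (edge_covering_number (enhanced_power_graph G)) \<and>
            real (edge_covering_number (enhanced_power_graph G))
              \<le> (real (order G) + (real t - 1)) / 2)"
proof -
  interpret group G
    by fact
  note bounds = edge_covering_number_enhanced_power_graph_bounds[OF assms(2)]
  show ?thesis
  \<comment> \<open>The instantiation splits only the outer conjunction and keeps the two bounds of
    the even case together.\<close>
  proof (intro conjI[of "_ \<longrightarrow> _"] impI)
    assume odd: "odd (order G) \<and> order G \<noteq> 1"
    \<comment> \<open>The edge from \<open>z\<close> will cover the identity; in the trivial group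
      the only vertex is isolated.\<close>
    then obtain z where z: "z \<in> carrier G" "z \<noteq> \<one>\<^bsub>G\<^esub>"
      using order_one_triv_iff one_closed by blast
    have no_inv: "involutions G = {}"
      using odd by (intro involutions_odd_order) simp
    have "order G \<le> 2 * edge_covering_number (enhanced_power_graph G)"
      and "2 * edge_covering_number (enhanced_power_graph G) \<le> order G + 1"
      using bounds[of "{z}"] z no_inv by auto
    \<comment> \<open>The left side is even and \<open>order G\<close> is odd, so the lower bound is
      strict.\<close>
    with odd have "2 * edge_covering_number (enhanced_power_graph G) = order G + 1"
      by presburger
    then have "real (2 * edge_covering_number (enhanced_power_graph G)) = real (order G + 1)"
      by (rule arg_cong)
    then show "real (edge_covering_number (enhanced_power_graph G)) = (real (order G) + 1) / 2"
      by simp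
  next
    assume "even (order G)"
    with card_inverse_pairs[OF assms(2)] have "odd (card (involutions G))"
      by presburger
    then have "involutions G \<noteq> {}"
      by auto
    moreover have "involutions G \<subseteq> carrier G - {\<one>\<^bsub>G\<^esub>}"
      by (auto simp: involutions_iff)
    \<comment> \<open>Here \<open>S\<close> is the set of involutions, so \<open>card S = t\<close>,
      and cancelling one \<open>t\<close> leaves \<open>order G + t - 1\<close> as the upper
      bound.\<close>
    ultimately have "order G \<le> 2 * edge_covering_number (enhanced_power_graph G)"
      and "2 * edge_covering_number (enhanced_power_graph G) + t + 1 \<le> order G + 2 * t"
      using bounds[of "involutions G"] assms(3) by auto
    then have "real (order G) \<le> real (2 * edge_covering_number (enhanced_power_graph G))"
      and "real (2 * edge_covering_number (enhanced_power_graph G) + t + 1) \<le> real (order G + 2 * t)"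
      by (simp_all only: of_nat_le_iff)
    then show "real (order G) / 2 \<le> real (edge_covering_number (enhanced_power_graph G)) \<and>
        real (edge_covering_number (enhanced_power_graph G)) \<le> (real (order G) + (real t - 1)) / 2"
      by simp
  qed
qed

end
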